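(* Every $3$-potent ring is commutative; that is, if $R$ is a ring with $x^3=x$ for all $x\in R$, then $R$ is commutative.
   Context: Rings are associative but are not assumed to have a unity. For an integer $n\geq 2$, a ring $R$ is called $n$-potent if $x^n=x$ for all $x\in R$. *)

theory Defs
  imports Main
begin

text \<open>
  The type class \<^class>\<open>ring\<close> is that of associative rings which need not have a unity.
  The library power \<open>x ^ n\<close> needs a unity, so positive powers are defined here for
  semigroups. Only exponents \<open>n \<ge> 1\<close> are meaningful (the value at \<open>n = 0\<close> is a dummy).
\<close>

definition pos_power :: "'a::semigroup_mult \<Rightarrow> nat \<Rightarrow> 'a" where
  "pos_power x n = ((\<lambda>y. x * y) ^^ (n - 1)) x"

lemma pos_power_1: "pos_power x 1 = x"
  by (simp add: pos_power_def)

lemma pos_power_Suc: "n \<ge> 1 \<Longrightarrow> pos_power x (Suc n) = x * pos_power x n"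
  by (cases n) (simp_all add: pos_power_def)

lemma pos_power_eq_power:
  fixes x :: "'a::monoid_mult"
  shows "n \<ge> 1 \<Longrightarrow> pos_power x n = x ^ n"
  by (induction n rule: nat_induct_at_least) (simp_all add: pos_power_1[simplified] pos_power_Suc)

definition potent_ring :: "nat \<Rightarrow> 'a::ring itself \<Rightarrow> bool" where
  "potent_ring n (_ :: 'a itself) \<longleftrightarrow> n \<ge> 2 \<and> (\<forall>x::'a. pos_power x n = x)"

end

theory Submission
  imports Defs
begin

text \<open>
  A 3-potent ring is reduced, so its idempotents are central; in particular all squares are.
  Applied to \<open>x + x\<^sup>2\<close>, centrality of squares makes \<open>2x\<close> central, while the cube identity
  gives \<open>3x = -3x\<^sup>2\<close>, so \<open>3x\<close> is central as well. Hence \<open>x = 3x - 2x\<close> is central.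
\<close>

text \<open>Regrouping the cube of \<open>b * a\<close> exposes the factor
  \<open>a * b\<close>.\<close>

lemma zero_product_commute:
  fixes a b :: "'a::ring"
  assumes cube: "\<And>x::'a. x * x * x = x" and ab: "a * b = 0"
  shows "b * a = 0"
proof -
  have "b * a = b * (a * b) * (a * b) * a"
    using cube[of "b * a"] by (simp add: mult.assoc)
  then show ?thesis
    by (simp add: ab)
qed

text \<open>Both products equal \<open>e * x * e\<close>: each difference is annihilated by
  \<open>e\<close> on one side, hence on the other by \<open>zero_product_commute\<close>, and on
  that other side \<open>e\<close> acts on it as an identity.\<close>

lemma idempotent_central:
  fixes e x :: "'a::ring"
  assumes cube: "\<And>x::'a. x * x * x = x" and e: "e * e = e"
  shows "e * x = x * e"
proof -
  have ee: "e * (e * z) = e * z" for z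
    using e by (simp flip: mult.assoc)
  have "(e * x - e * x * e) * e = 0"
    by (simp add: left_diff_distrib mult.assoc e)
  then have "e * (e * x - e * x * e) = 0"
    by (rule zero_product_commute[OF cube])
  then have 1: "e * x = e * x * e"
    by (simp add: right_diff_distrib mult.assoc ee e)
  have "e * (x * e - e * x * e) = 0"
    by (simp add: algebra_simps ee)
  then have "(x * e - e * x * e) * e = 0"
    by (rule zero_product_commute[OF cube])
  then have 2: "x * e = e * x * e"
    by (simp add: left_diff_distrib mult.assoc e)
  show ?thesis
    using 1 2 by simp
qed

theorem theorem2p7:
  assumes "potent_ring 3 TYPE('a::ring)"
  shows "\<forall>x y :: 'a. x * y = y * x"
proof (intro allI)
  fix x y :: 'a
  have cube: "z * z * z = z" for z :: 'a
    using assms by (simp add: potent_ring_def pos_power_def numeral_3_eq_3 mult.assoc)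
  \<comment> \<open>The square \<open>z * z\<close> is idempotent, since
    \<open>z * z * z * z\<close> collapses by the cube identity.\<close>
  have square_central: "z * z * w = w * (z * z)" for z w :: 'a
    by (rule idempotent_central[OF cube]) (metis cube mult.assoc)
  have x3: "x * (x * x) = x"
    using cube[of x] by (simp add: mult.assoc)
  let ?s = "x + x * x"
  have sq: "?s * ?s = (x * x + x * x) + (x + x)"
    by (simp add: algebra_simps x3)
  \<comment> \<open>Both \<open>?s * ?s\<close> and \<open>x * x\<close> commute with
    \<open>y\<close>, so the square terms in \<open>sq\<close> cancel.\<close>
  have "(x + x) * y = y * (x + x)"
    using square_central[of ?s y] square_central[of x y] unfolding sq
    by (simp add: distrib_left distrib_right)
  moreover have "(x + x + x) * y = y * (x + x + x)"
  proof -
    \<comment> \<open>The cube is 4x + 4x^2; one \<open>?s\<close> is split off so that it cancels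
      against the cube identity for \<open>?s\<close>.\<close>
    have "?s * ?s * ?s = ?s + (x + x + x) + (x * x + x * x + x * x)"
      unfolding sq by (simp add: algebra_simps x3)
    then have "(x + x + x) + (x * x + x * x + x * x) = 0"
      unfolding cube by (simp add: add.assoc)
    then have "x + x + x = - (x * x + x * x + x * x)"
      by (simp only: eq_neg_iff_add_eq_0)
    then show ?thesis
      by (simp only: minus_mult_left[symmetric] minus_mult_right[symmetric]
          distrib_left distrib_right square_central[of x y])
  qed
  ultimately show "x * y = y * x"
    by (simp add: distrib_left distrib_right)
qed

end
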